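(* For any integer $b\geq 2$ and any $n\geq b^2+b$, there are exactly $b^2$ smooth arithmetical structures on $D_n$ with $\bar r_y=b$.
   Context: For $n\ge 3$ let $\ell=n-3$. The bident $D_n$ has vertices $v_x,v_y,v_0,\dots,v_\ell$ and edges $v_xv_0$, $v_yv_0$, $v_iv_{i+1}$ ($0\le i\le\ell-1$). An arithmetical structure on $D_n$ is a pair $(\mathbf d,\mathbf r)$, $\mathbf d=(d_x,d_y,d_0,\dots,d_\ell)$, $\mathbf r=(r_x,r_y,r_0,\dots,r_\ell)$, of positive integer vectors with $(\operatorname{diag}(\mathbf d)-A)\mathbf r=\mathbf 0$ ($A$ the adjacency matrix) and $\mathbf r$ primitive. It is smooth if $d_x,d_y,d_1,\dots,d_\ell\ge2$. For such a structure, $\bar{\mathbf r}=\frac{r_0}{r_xr_y}\mathbf r$. *)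

theory Defs
  imports "Jordan_Normal_Form.Matrix"
begin

text \<open>Matrices and vectors are indexed from 0; the vertices of the bident on \<open>n\<close>
  vertices are numbered \<open>0, \<dots>, n - 1\<close> in the order
  \<open>v\<^sub>x, v\<^sub>y, v\<^sub>0, \<dots>, v\<^sub>\<ell>\<close>, where \<open>\<ell> = n - 3\<close>.\<close>

abbreviation (input) v_x :: nat where "v_x \<equiv> 0"
abbreviation (input) v_y :: nat where "v_y \<equiv> 1"
abbreviation (input) v_path :: "nat \<Rightarrow> nat" where "v_path i \<equiv> i + 2"

definition bident_edges :: "nat \<Rightarrow> nat set set" where
  "bident_edges n =
     {{v_x, v_path 0}, {v_y, v_path 0}} \<union> {{v_path i, v_path (i + 1)} | i. i < n - 3}"

definition adjacency_mat :: "nat \<Rightarrow> nat set set \<Rightarrow> int mat" where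
  "adjacency_mat n E = mat n n (\<lambda>(i, j). if {i, j} \<in> E then 1 else 0)"

definition arithmetical_structure :: "nat \<Rightarrow> nat set set \<Rightarrow> int vec \<Rightarrow> int vec \<Rightarrow> bool" where
  "arithmetical_structure n E d r \<longleftrightarrow>
     d \<in> carrier_vec n \<and> r \<in> carrier_vec n \<and>
     (\<forall>i<n. d $ i > 0) \<and> (\<forall>i<n. r $ i > 0) \<and>
     (mat_diag n (\<lambda>i. d $ i) - adjacency_mat n E) *\<^sub>v r = 0\<^sub>v n \<and>
     Gcd ((\<lambda>i. r $ i) ` {..<n}) = 1"

definition smooth_bident :: "nat \<Rightarrow> int vec \<Rightarrow> bool" where
  "smooth_bident n d \<longleftrightarrow>
     d $ v_x \<ge> 2 \<and> d $ v_y \<ge> 2 \<and> (\<forall>i\<in>{1..n - 3}. d $ v_path i \<ge> 2)"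

definition rbar :: "int vec \<Rightarrow> rat vec" where
  "rbar r = (of_int (r $ v_path 0) / (of_int (r $ v_x) * of_int (r $ v_y))) \<cdot>\<^sub>v map_vec of_int r"

end

theory Submission
  imports Defs
begin

text \<open>The value \<open>b = rbar\<^sub>y\<close> is the coefficient \<open>d\<^sub>x\<close>. Smoothness makes \<open>r\<close> strictly
  decreasing along the path and forces \<open>d\<^sub>0 = 1\<close>, so with \<open>c = d\<^sub>y\<close> the path entries of \<open>r\<close>
  are proportional to the remainders of the Hirzebruch--Jung expansion of \<open>bc / (bc - b - c)\<close>,
  and \<open>c\<close> determines the structure. Hence one counts the \<open>c \<ge> 2\<close> for which this
  expansion has length \<open>n - 3\<close>. Let \<open>H(u, v)\<close> be the number of positive remainders starting
  from \<open>v\<close>; it depends on \<open>u\<close> only modulo \<open>v\<close>, satisfies \<open>H(s, ks + r) = k + H(s, r)\<close>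
  and is at most \<open>v\<close>. For \<open>c = b\<^sup>2 - b + qb\<^sup>2 + t\<close> with \<open>1 \<le> t \<le> b\<^sup>2\<close> this gives
  \<open>H(b + c, bc) = b - 1 + q + H(b\<^sup>2, t)\<close>, so each of the \<open>b\<^sup>2\<close> residues \<open>t\<close> contributes
  exactly one \<open>q\<close> once \<open>n \<ge> b\<^sup>2 + b\<close>, while \<open>c \<le> b\<^sup>2 - b\<close> gives too small a length.\<close>

section \<open>Hirzebruch--Jung remainders\<close>

lemma mod_eqI_int:
  fixes a m x k :: int
  assumes "0 \<le> x" "x < m" "a = k * m + x"
  shows "a mod m = x"
  using assms by (simp add: mod_pos_pos_trivial)

text \<open>For v > 0 this is division with negative remainder, u = q v - r with 0 <= r < v: the
  shape of a path equation d_{i+1} r_{i+1} = r_i + r_{i+2} that determines r_{i+2}. The listing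
  begins at \<open>v\<close>; \<open>u\<close> only feeds the first division.\<close>

primrec hj_rem :: "int \<Rightarrow> int \<Rightarrow> nat \<Rightarrow> int" where
  "hj_rem u v 0 = v"
| "hj_rem u v (Suc i) = hj_rem v ((- u) mod v) i"

function hj_length :: "int \<Rightarrow> int \<Rightarrow> nat" where
  "hj_length u v = (if v \<le> 0 then 0 else Suc (hj_length v ((- u) mod v)))"
  by auto
termination
  by (relation "measure (\<lambda>(u, v). nat v)") auto

declare hj_length.simps [simp del]

lemma hj_rem_Suc_Suc: "hj_rem u v (Suc (Suc i)) = (- hj_rem u v i) mod hj_rem u v (Suc i)"
proof (induction i arbitrary: u v)
  case 0
  show ?case by simp
next
  case (Suc i)
  show ?case using Suc.IH [of v "(- u) mod v"] by simp
qed

text \<open>Since \<open>x mod 0 = x\<close>, the values of \<open>hj_rem\<close> beyond the first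
  zero are meaningless; the length is the position of that zero.\<close>

lemma hj_length_eq_iff:
  "v \<ge> 0 \<Longrightarrow> hj_length u v = k \<longleftrightarrow> (\<forall>i<k. hj_rem u v i > 0) \<and> hj_rem u v k = 0"
proof (induction k arbitrary: u v)
  case 0
  then show ?case by (auto simp: hj_length.simps [of u v])
next
  case (Suc k)
  show ?case
  proof (cases "v = 0")
    case True
    then have "hj_length u v = 0" "hj_rem u v 0 = 0" by (simp_all add: hj_length.simps [of u 0])
    then show ?thesis by (metis less_irrefl nat.distinct(1) zero_less_Suc)
  next
    case False
    then have "v > 0" using Suc.prems by simp
    then have "hj_length u v = Suc k \<longleftrightarrow> hj_length v ((- u) mod v) = k"
      by (simp add: hj_length.simps [of u v])
    also have "\<dots> \<longleftrightarrow> (\<forall>i<k. hj_rem u v (Suc i) > 0) \<and> hj_rem u v (Suc k) = 0"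
      using \<open>v > 0\<close> by (simp add: Suc.IH)
    finally show ?thesis using \<open>v > 0\<close> by (auto simp: All_less_Suc2)
  qed
qed

lemma hj_length_0 [simp]: "hj_length u 0 = 0"
  by (simp add: hj_length.simps [of u 0])

lemma hj_length_cong:
  assumes "u mod v = u' mod v"
  shows "hj_length u v = hj_length u' v"
proof -
  have "(- u) mod v = (- u') mod v" using assms by (rule mod_minus_cong)
  then show ?thesis by (simp only: hj_length.simps [of u v] hj_length.simps [of u' v])
qed

lemma hj_length_le: "hj_length u v \<le> nat v"
proof (induction u v rule: hj_length.induct)
  case (1 u v)
  show ?case
  proof (cases "v \<le> 0")
    case False
    then have "0 \<le> (- u) mod v" "(- u) mod v < v" by simp_all
    moreover have "hj_length u v = Suc (hj_length v ((- u) mod v))"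
      using False by (simp add: hj_length.simps [of u v])
    ultimately show ?thesis using 1 [OF False] by linarith
  qed (simp add: hj_length.simps [of u v])
qed

text \<open>From s = (s + r) - r the next remainder is r, and s + r is congruent to s modulo
  r.\<close>

lemma hj_length_add:
  assumes "s > 0" "r \<ge> 0"
  shows "hj_length s (s + r) = Suc (hj_length s r)"
proof -
  have "(- s) mod (s + r) = r"
    using assms by (intro mod_eqI_int [where k = "-1"]) auto
  moreover have "hj_length (s + r) r = hj_length s r"
    by (rule hj_length_cong) simp
  ultimately show ?thesis using assms by (simp add: hj_length.simps [of s "s + r"])
qed

lemma hj_length_add_mult:
  assumes "s > 0" "r \<ge> 0"
  shows "hj_length s (int k * s + r) = k + hj_length s r"
proof (induction k)
  case (Suc k)
  then show ?case
    using hj_length_add [OF assms(1), of "int k * s + r"] assms by (simp add: algebra_simps)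
qed simp

section \<open>Counting the second leaf coefficient\<close>

text \<open>Put m = c - b^2 + b. Then bc = (b - 1)(b + c) + m, which splits off b - 1 steps; b + c =
  b^2 + m is congruent to b^2 modulo m; and m = q b^2 + t splits off q more. The value t = 0 is
  allowed so that c = b^2 - b is covered.\<close>

lemma hj_length_large:
  fixes b q :: nat and t :: int
  assumes "b \<ge> 1" "t \<ge> 0"
  defines "c \<equiv> int b ^ 2 - int b + (int q * int b ^ 2 + t)"
  shows "hj_length (int b + c) (int b * c) = b - 1 + q + hj_length (int b ^ 2) t"
proof -
  let ?B = "int b" and ?m = "int q * int b ^ 2 + t"
  have pos: "?B ^ 2 > 0" "?m \<ge> 0" using assms by auto
  have "?B + c > 0" using pos unfolding c_def by linarith
  moreover have "?B * c = int (b - 1) * (?B + c) + ?m"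
    using assms by (simp add: c_def of_nat_diff algebra_simps power2_eq_square)
  ultimately have "hj_length (?B + c) (?B * c) = b - 1 + hj_length (?B + c) ?m"
    using pos by (metis hj_length_add_mult)
  also have "hj_length (?B + c) ?m = hj_length (?B ^ 2) ?m"
    by (rule hj_length_cong) (simp add: c_def)
  also have "\<dots> = q + hj_length (?B ^ 2) t"
    using pos assms by (intro hj_length_add_mult) auto
  finally show ?thesis by simp
qed

text \<open>Writing bc = q(b + c) + t, the length is at most q + t, where q <= b - 1 and t <= b + c
  - 1.\<close>

lemma hj_length_small:
  fixes b :: nat and c :: int
  assumes "b \<ge> 2" "c \<ge> 2" "c \<le> int b ^ 2 - int b"
  shows "hj_length (int b + c) (int b * c) < b ^ 2 + b - 2"
\<comment> \<open>For this c the bound on q + t is b^2 + b - 2, one too large, so the exact length b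
  - 1 is used.\<close>
proof (cases "c = int b ^ 2 - int b")
  case True
  have "hj_length (int b + c) (int b * c) = b - 1"
    using hj_length_large [of b 0 0] assms(1) True by simp
  moreover have "b ^ 2 \<ge> 2 * 2" using assms(1) using mult_le_mono [of 2 b 2 b] by (simp add: power2_eq_square)
  ultimately show ?thesis using assms(1) by linarith
next
  case False
  let ?s = "int b + c"
  define q where "q = int b * c div ?s"
  define t where "t = int b * c mod ?s"
  have s: "?s > 0" using assms by simp
  have t: "0 \<le> t" "t < ?s" using s by (auto simp: t_def)
  have q0: "q \<ge> 0" using s assms by (simp add: q_def pos_imp_zdiv_nonneg_iff)
  have eq: "int b * c = q * ?s + t" unfolding q_def t_def by (rule div_mult_mod_eq [symmetric])
  have "q * ?s \<le> int b * c" using eq t by simp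
  also have "\<dots> < int b * ?s" using assms by (simp add: algebra_simps)
  finally have q: "q < int b" using s mult_less_cancel_right_pos by blast
  have "hj_length ?s (int b * c) = nat q + hj_length ?s t"
    using hj_length_add_mult [OF s t(1), of "nat q"] q0 eq by simp
  also have "\<dots> \<le> nat q + nat t" using hj_length_le by simp
  finally have "int (hj_length ?s (int b * c)) \<le> q + t" using q0 t by linarith
  also have "\<dots> < int b ^ 2 + int b - 2" using q t False assms(3) by linarith
  also have "\<dots> = int (b ^ 2 + b - 2)" using assms(1) by (simp add: of_nat_diff)
  finally show ?thesis by simp
qed

lemma card_leaf_coefficients:
  fixes b N :: nat
  assumes b: "b \<ge> 2" and N: "N \<ge> b ^ 2 + b - 2"
  shows "card {c. c \<ge> 2 \<and> hj_length (int b + c) (int b * c) = N} = b ^ 2"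
proof -
  let ?B = "int b"
  define K where "K t = hj_length (?B ^ 2) t" for t
  \<comment> \<open>The only c in the class of t with length N: \<open>hj_length_large\<close>
    solved for q. Letting t run over 1, ..., b^2 instead of 0, ..., b^2 - 1 makes every q >= 0 give
    c > b^2 - b, the range left by \<open>hj_length_small\<close>.\<close>
  define f where "f t = ?B ^ 2 - ?B + (int (N - (b - 1) - K t) * ?B ^ 2 + t)" for t
  have b2: "b ^ 2 \<ge> 2 * b" using b by (simp add: power2_eq_square)
  then have B2: "?B ^ 2 \<ge> 2 * ?B" by (metis of_nat_le_iff of_nat_mult of_nat_numeral of_nat_power)
  have "?B ^ 2 > 0" using b by simp
  \<comment> \<open>This makes the natural number subtraction in \<open>f\<close> exact. For t < b^2
    the bound K t <= t <= b^2 - 1 suffices and uses the full hypothesis on N; t = b^2 would exceed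
    it by one, but there K t = 1.\<close>
  have K: "K t + (b - 1) \<le> N" if "t \<in> {1..?B ^ 2}" for t
  proof (cases "t = ?B ^ 2")
    case True
    have "K t = 1"
      using hj_length_add [of "?B ^ 2" 0] \<open>?B ^ 2 > 0\<close> True by (simp add: K_def)
    then show ?thesis using b b2 N by linarith
  next
    case False
    have "K t \<le> nat t" by (simp add: K_def hj_length_le)
    also have "\<dots> < b ^ 2" using that False by (simp add: nat_less_iff)
    finally show ?thesis using b b2 N by linarith
  qed
  have "{c. c \<ge> 2 \<and> hj_length (?B + c) (?B * c) = N} = f ` {1..?B ^ 2}" (is "?C = _")
  proof (intro equalityI subsetI)
    fix c assume "c \<in> ?C"
    then have c: "c \<ge> 2" "hj_length (?B + c) (?B * c) = N" by auto
    then have "c > ?B ^ 2 - ?B" using hj_length_small [OF b c(1)] N by force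
    \<comment> \<open>The shift by 1 turns division by b^2 into a quotient q and a remainder t in 1,
      ..., b^2.\<close>
    define m where "m = c - (?B ^ 2 - ?B) - 1"
    have "m \<ge> 0" using \<open>c > _\<close> by (simp add: m_def)
    define q where "q = nat (m div ?B ^ 2)"
    define t where "t = m mod ?B ^ 2 + 1"
    have t: "t \<in> {1..?B ^ 2}"
      using pos_mod_bound [OF \<open>?B ^ 2 > 0\<close>, of m] pos_mod_sign [OF \<open>?B ^ 2 > 0\<close>, of m]
      unfolding t_def atLeastAtMost_iff by linarith
    have "int q = m div ?B ^ 2"
      using \<open>m \<ge> 0\<close> \<open>?B ^ 2 > 0\<close> by (simp add: q_def pos_imp_zdiv_nonneg_iff)
    then have "m + 1 = int q * ?B ^ 2 + t"
      using div_mult_mod_eq [of m "?B ^ 2"] by (simp only: t_def)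
    then have c_eq: "c = ?B ^ 2 - ?B + (int q * ?B ^ 2 + t)" by (simp add: m_def)
    have "N = b - 1 + q + K t"
      using hj_length_large [of b t q] b t c(2) by (simp add: c_eq K_def)
    then have "q = N - (b - 1) - K t" by simp
    then show "c \<in> f ` {1..?B ^ 2}" using c_eq t by (auto simp: f_def)
  next
    fix c assume "c \<in> f ` {1..?B ^ 2}"
    then obtain t where t: "t \<in> {1..?B ^ 2}" "c = f t" by auto
    have "hj_length (?B + c) (?B * c) = N"
      using hj_length_large [of b t "N - (b - 1) - K t"] b t K [OF t(1)]
      by (simp add: f_def K_def)
    moreover have "int (N - (b - 1) - K t) * ?B ^ 2 \<ge> 0" by simp
    then have "c \<ge> ?B ^ 2 - ?B + 1" using t unfolding f_def atLeastAtMost_iff by linarith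
    then have "c \<ge> 2" using B2 b by linarith
    ultimately show "c \<in> ?C" by simp
  qed
  moreover have "inj_on f {1..?B ^ 2}"
  proof (rule inj_onI)
    fix t t' assume tt: "t \<in> {1..?B ^ 2}" "t' \<in> {1..?B ^ 2}" "f t = f t'"
    \<comment> \<open>The residue of c modulo b^2 recovers t, whatever the quotient is.\<close>
    have res: "(f x - (?B ^ 2 - ?B) - 1) mod ?B ^ 2 = x - 1" if "x \<in> {1..?B ^ 2}" for x
    proof -
      have "f x - (?B ^ 2 - ?B) - 1 = (x - 1) + int (N - (b - 1) - K x) * ?B ^ 2"
        by (simp add: f_def)
      then show ?thesis using that by (simp only: mod_mult_self1) simp
    qed
    have "t - 1 = t' - 1" using res [OF tt(1)] res [OF tt(2)] tt(3) by metis
    then show "t = t'" by simp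
  qed
  ultimately show ?thesis by (simp add: card_image nat_power_eq)
qed

section \<open>Arithmetical structures on the bident\<close>

lemma arithmetical_structure_iff:
  "arithmetical_structure n E d r \<longleftrightarrow>
     d \<in> carrier_vec n \<and> r \<in> carrier_vec n \<and> (\<forall>i<n. d $ i > 0) \<and> (\<forall>i<n. r $ i > 0) \<and>
     (\<forall>i<n. d $ i * r $ i = (\<Sum>j | j < n \<and> {i, j} \<in> E. r $ j)) \<and>
     Gcd ((\<lambda>i. r $ i) ` {..<n}) = 1"
proof -
  have "((mat_diag n (\<lambda>i. d $ i) - adjacency_mat n E) *\<^sub>v r) $ i
          = d $ i * r $ i - (\<Sum>j | j < n \<and> {i, j} \<in> E. r $ j)"
    if "i < n" "r \<in> carrier_vec n" for i
  proof -
    have "((mat_diag n (\<lambda>i. d $ i) - adjacency_mat n E) *\<^sub>v r) $ i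
            = (\<Sum>j<n. ((if i = j then d $ j else 0) - (if {i, j} \<in> E then 1 else 0)) * r $ j)"
      using that
      by (auto simp: scalar_prod_def mat_diag_def adjacency_mat_def atLeast0LessThan
          intro!: sum.cong)
    also have "\<dots> = (\<Sum>j<n. if i = j then d $ j * r $ j else 0)
                    - (\<Sum>j<n. if {i, j} \<in> E then r $ j else 0)"
      unfolding sum_subtractf [symmetric] by (rule sum.cong) (auto simp: algebra_simps)
    also have "(\<Sum>j<n. if i = j then d $ j * r $ j else 0) = d $ i * r $ i"
      using that by simp
    also have "(\<Sum>j<n. if {i, j} \<in> E then r $ j else 0) = (\<Sum>j | j < n \<and> {i, j} \<in> E. r $ j)"
      by (subst sum.inter_filter [symmetric]) (auto intro: sum.cong)
    finally show ?thesis .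
  qed
  moreover have "dim_vec ((mat_diag n (\<lambda>i. d $ i) - adjacency_mat n E) *\<^sub>v r) = n"
    by (simp add: adjacency_mat_def)
  ultimately have "r \<in> carrier_vec n \<Longrightarrow>
     (mat_diag n (\<lambda>i. d $ i) - adjacency_mat n E) *\<^sub>v r = 0\<^sub>v n \<longleftrightarrow>
     (\<forall>i<n. d $ i * r $ i = (\<Sum>j | j < n \<and> {i, j} \<in> E. r $ j))"
    by (auto simp: vec_eq_iff)
  then show ?thesis unfolding arithmetical_structure_def by blast
qed

lemma bident_edges_iff:
  "{i, j} \<in> bident_edges n \<longleftrightarrow>
     {i, j} = {0, 2} \<or> {i, j} = {1, 2} \<or>
     (i \<ge> 2 \<and> i + 1 < n \<and> j = i + 1) \<or> (j \<ge> 2 \<and> j + 1 < n \<and> i = j + 1)"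
proof -
  have "(\<exists>k. {i, j} = {k + 2, k + 1 + 2} \<and> k < n - 3) \<longleftrightarrow>
     (i \<ge> 2 \<and> i + 1 < n \<and> j = i + 1) \<or> (j \<ge> 2 \<and> j + 1 < n \<and> i = j + 1)" (is "?L = ?R")
  proof
    assume ?L
    then show ?R by (auto simp: doubleton_eq_iff)
  next
    assume ?R
    then show ?L
    proof
      assume "i \<ge> 2 \<and> i + 1 < n \<and> j = i + 1"
      then show ?L by (intro exI [of _ "i - 2"]) auto
    next
      assume "j \<ge> 2 \<and> j + 1 < n \<and> i = j + 1"
      then show ?L by (intro exI [of _ "j - 2"]) auto
    qed
  qed
  then show ?thesis unfolding bident_edges_def by (simp add: numeral_2_eq_2)
qed

text \<open>The path coefficients, continued by the value 0 past the last vertex, so that the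
  end of the path satisfies the same recurrence as its interior.\<close>

definition path_coeff :: "nat \<Rightarrow> int vec \<Rightarrow> nat \<Rightarrow> int" where
  "path_coeff n r i = (if i + 2 < n then r $ (i + 2) else 0)"

text \<open>Index i + 3 is the vertex v_{i+1}, with neighbours v_i and v_{i+2}. The last vertex is
  the case i = n - 4, where \<open>path_coeff n r (i + 2)\<close> is the added zero.\<close>

lemma bident_structure_iff:
  assumes "n \<ge> 4"
  shows "arithmetical_structure n (bident_edges n) d r \<longleftrightarrow>
     d \<in> carrier_vec n \<and> r \<in> carrier_vec n \<and> (\<forall>i<n. d $ i > 0) \<and> (\<forall>i<n. r $ i > 0) \<and>
     d $ 0 * r $ 0 = path_coeff n r 0 \<and> d $ 1 * r $ 1 = path_coeff n r 0 \<and>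
     d $ 2 * path_coeff n r 0 = r $ 0 + r $ 1 + path_coeff n r 1 \<and>
     (\<forall>i<n - 3. d $ (i + 3) * path_coeff n r (i + 1) = path_coeff n r i + path_coeff n r (i + 2)) \<and>
     Gcd ((\<lambda>i. r $ i) ` {..<n}) = 1"
proof -
  define S where "S i = (\<Sum>j | j < n \<and> {i, j} \<in> bident_edges n. r $ j)" for i
  have nb: "{j. j < n \<and> {0, j} \<in> bident_edges n} = {2}"
    "{j. j < n \<and> {1, j} \<in> bident_edges n} = {2}"
    "{j. j < n \<and> {2, j} \<in> bident_edges n} = {0, 1, 3}"
    using assms by (auto simp: bident_edges_iff doubleton_eq_iff)
  have S: "S 0 = path_coeff n r 0" "S 1 = path_coeff n r 0"
    "S 2 = r $ 0 + r $ 1 + path_coeff n r 1"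
    unfolding S_def nb using assms by (auto simp: path_coeff_def numeral_2_eq_2 numeral_3_eq_3)
  have S': "S (i + 3) = path_coeff n r i + path_coeff n r (i + 2)" if "i < n - 3" for i
  proof -
    have "{i + 3, j} \<in> bident_edges n \<longleftrightarrow> j = i + 2 \<or> j = i + 4 \<and> i + 4 < n" for j
      unfolding bident_edges_iff doubleton_eq_iff using that by auto
    then have S_eq: "S (i + 3) = sum (($) r) {j. j < n \<and> (j = i + 2 \<or> j = i + 4 \<and> i + 4 < n)}"
      by (simp add: S_def)
    show ?thesis
    proof (cases "i + 4 < n")
      case True
      then have "{j. j < n \<and> (j = i + 2 \<or> j = i + 4 \<and> i + 4 < n)} = {i + 2, i + 4}" by auto
      then show ?thesis using True unfolding S_eq by (simp add: path_coeff_def numeral_eq_Suc)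
    next
      case False
      then have "{j. j < n \<and> (j = i + 2 \<or> j = i + 4 \<and> i + 4 < n)} = {i + 2}" using that by auto
      then show ?thesis using False that by (simp add: S_eq path_coeff_def)
    qed
  qed
  have all: "(\<forall>i<n. P i) \<longleftrightarrow> P 0 \<and> P 1 \<and> P 2 \<and> (\<forall>i<n - 3. P (i + 3))" for P
  proof
    assume R: "P 0 \<and> P 1 \<and> P 2 \<and> (\<forall>i<n - 3. P (i + 3))"
    show "\<forall>i<n. P i"
    proof (intro allI impI)
      fix i assume "i < n"
      show "P i"
      proof (cases "i < 3")
        case True
        then have "i = 0 \<or> i = 1 \<or> i = 2" by linarith
        then show ?thesis using R by blast
      next
        case False
        then have "i = (i - 3) + 3" "i - 3 < n - 3" using \<open>i < n\<close> by linarith+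
        then show ?thesis using R by metis
      qed
    qed
  qed (use assms in auto)
  have r: "r $ 2 = path_coeff n r 0"
    using assms by (simp add: path_coeff_def numeral_2_eq_2)
  have r': "r $ (i + 3) = path_coeff n r (i + 1)" if "i < n - 3" for i
    using that by (simp add: path_coeff_def numeral_3_eq_3)
  have "(\<forall>i<n. d $ i * r $ i = S i) \<longleftrightarrow>
     d $ 0 * r $ 0 = path_coeff n r 0 \<and> d $ 1 * r $ 1 = path_coeff n r 0 \<and>
     d $ 2 * path_coeff n r 0 = r $ 0 + r $ 1 + path_coeff n r 1 \<and>
     (\<forall>i<n - 3. d $ (i + 3) * path_coeff n r (i + 1) = path_coeff n r i + path_coeff n r (i + 2))"
    unfolding all [of "\<lambda>i. d $ i * r $ i = S i"] S r using S' r' by simp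
  then show ?thesis unfolding arithmetical_structure_iff S_def [symmetric] by blast
qed

section \<open>The remainder sequence of a smooth structure\<close>

context
  fixes n :: nat and b c :: int and d r :: "int vec"
  assumes n: "n \<ge> 4" and b: "b \<ge> 2" and c: "c \<ge> 2"
    and str: "arithmetical_structure n (bident_edges n) d r"
    and smooth: "smooth_bident n d" and d0: "d $ 0 = b" and d1: "d $ 1 = c"
begin

lemma path_coeff_pos: "i < n - 2 \<Longrightarrow> path_coeff n r i > 0"
  using str unfolding bident_structure_iff [OF n] by (simp add: path_coeff_def)

text \<open>Induction from the far end, where the added zero lies below the last positive entry.
  Inwards, d_{i+1} >= 2 gives r_i - r_{i+1} >= r_{i+1} - r_{i+2} > 0.\<close>

lemma path_coeff_decreasing:
  assumes "i < n - 2"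
  shows "path_coeff n r (i + 1) < path_coeff n r i"
proof -
  have "i \<le> n - 3" using assms by simp
  then show ?thesis
  proof (induction rule: inc_induct)
    case base
    have "path_coeff n r (n - 3 + 1) = 0" using n by (simp add: path_coeff_def)
    then show ?case using path_coeff_pos [of "n - 3"] n by simp
  next
    case (step i)
    have "path_coeff n r (i + 1) > 0" using path_coeff_pos step by simp
    moreover have "d $ (i + 3) \<ge> 2"
      using smooth step.hyps bspec [of "{1..n - 3}" "\<lambda>j. d $ (j + 2) \<ge> 2" "i + 1"]
      by (simp add: smooth_bident_def numeral_3_eq_3)
    ultimately have "d $ (i + 3) * path_coeff n r (i + 1) \<ge> 2 * path_coeff n r (i + 1)"
      by (intro mult_right_mono) auto
    moreover have "d $ (i + 3) * path_coeff n r (i + 1) = path_coeff n r i + path_coeff n r (i + 2)"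
      using str step unfolding bident_structure_iff [OF n] by blast
    ultimately show ?case using step.IH by simp
  qed
qed

text \<open>Both leaf entries are at most r_0 / 2 and r_1 < r_0, so d_0 r_0 < 2 r_0.\<close>

lemma smooth_bident_center:
  shows "d $ 2 = 1"
    and "path_coeff n r 1 = path_coeff n r 0 - r $ 0 - r $ 1"
proof -
  let ?\<rho> = "path_coeff n r"
  have eqs: "b * r $ 0 = ?\<rho> 0" "c * r $ 1 = ?\<rho> 0" "d $ 2 * ?\<rho> 0 = r $ 0 + r $ 1 + ?\<rho> 1"
    and pos: "r $ 0 > 0" "r $ 1 > 0" "d $ 2 > 0"
    using str n d0 d1 unfolding bident_structure_iff [OF n] by auto
  have "2 * r $ 0 \<le> b * r $ 0" "2 * r $ 1 \<le> c * r $ 1"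
    using b c pos by (auto intro: mult_right_mono)
  moreover have "?\<rho> 1 < ?\<rho> 0" using path_coeff_decreasing [of 0] n by simp
  ultimately have "d $ 2 * ?\<rho> 0 < 2 * ?\<rho> 0" using eqs by linarith
  then have "d $ 2 < 2" using path_coeff_pos [of 0] n by simp
  then show "d $ 2 = 1" using pos by simp
  then show "?\<rho> 1 = ?\<rho> 0 - r $ 0 - r $ 1" using eqs by simp
qed

text \<open>Up to the factor r_0 / (bc), the path starts with bc and bc - b - c, because r_x = r_0 /
  b and r_y = r_0 / c. By monotonicity each path equation is a division with negative remainder, and
  scaling commutes with \<open>mod\<close>. The identity is cross-multiplied to stay in the
  integers.\<close>

lemma path_coeff_eq_hj_rem:
  assumes "i \<le> n - 2"
  shows "b * c * path_coeff n r i = path_coeff n r 0 * hj_rem (b + c) (b * c) i"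
  using assms
proof (induction i rule: induct_nat_012)
  case 0
  show ?case by simp
next
  case 1
  let ?\<rho> = "path_coeff n r"
  \<comment> \<open>Shows bc - b - c >= 0, so that it is the reduced residue of -(b + c) modulo
    bc.\<close>
  have "b * c - b - c = (b - 1) * (c - 1) - 1" by (simp add: algebra_simps)
  moreover have "(b - 1) * (c - 1) \<ge> 1 * 1" using b c by (intro mult_mono) auto
  ultimately have "(- (b + c)) mod (b * c) = b * c - b - c"
    using b c by (intro mod_eqI_int [where k = "-1"]) auto
  moreover have leaves: "b * r $ 0 = ?\<rho> 0" "c * r $ 1 = ?\<rho> 0"
    using str d0 d1 unfolding bident_structure_iff [OF n] by auto
  have "b * c * ?\<rho> 1 = b * c * ?\<rho> 0 - c * (b * r $ 0) - b * (c * r $ 1)"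
    unfolding smooth_bident_center(2) by (simp add: algebra_simps)
  then have "b * c * ?\<rho> 1 = ?\<rho> 0 * (b * c - b - c)"
    unfolding leaves by (simp add: algebra_simps)
  ultimately show ?case by simp
next
  case (ge2 i)
  let ?\<rho> = "path_coeff n r" and ?h = "hj_rem (b + c) (b * c)"
  have rec: "d $ (i + 3) * ?\<rho> (i + 1) = ?\<rho> i + ?\<rho> (i + 2)"
    using str ge2.prems unfolding bident_structure_iff [OF n] by force
  have "?\<rho> (i + 2) \<ge> 0"
    using path_coeff_pos [of "i + 2"]
    by (cases "i + 2 < n - 2") (auto simp: path_coeff_def)
  moreover have "?\<rho> (i + 2) < ?\<rho> (i + 1)"
    using path_coeff_decreasing [of "i + 1"] ge2.prems by simp
  ultimately have "(- ?\<rho> i) mod ?\<rho> (i + 1) = ?\<rho> (i + 2)"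
    using rec by (intro mod_eqI_int [where k = "- d $ (i + 3)"]) auto
  then have "b * c * ?\<rho> (i + 2) = (b * c * (- ?\<rho> i)) mod (b * c * ?\<rho> (i + 1))"
    by (metis mult_mod_right)
  also have "\<dots> = (?\<rho> 0 * (- ?h i)) mod (?\<rho> 0 * ?h (Suc i))"
    using ge2 by simp
  also have "\<dots> = ?\<rho> 0 * ?h (i + 2)"
    by (simp only: mult_mod_right [symmetric] hj_rem_Suc_Suc add_2_eq_Suc')
  finally show ?case by simp
qed

text \<open>The starting term bc is counted too: one term for each of the n - 2 vertices v_0, ...,
  v_{n-3}, against n - 3 coefficients d_1, ..., d_{n-3}.\<close>

lemma hj_length_of_structure: "hj_length (b + c) (b * c) = n - 2"
proof -
  have bc: "b * c > 0" using b c by simp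
  have p0: "path_coeff n r 0 > 0" using path_coeff_pos n by simp
  have "hj_rem (b + c) (b * c) i > 0" if "i < n - 2" for i
  proof -
    have "path_coeff n r 0 * hj_rem (b + c) (b * c) i > 0"
      using path_coeff_eq_hj_rem [of i] that bc path_coeff_pos [OF that]
      by (metis less_imp_le mult_pos_pos)
    then show ?thesis using p0 by (simp add: zero_less_mult_iff)
  qed
  moreover have "path_coeff n r (n - 2) = 0" by (simp add: path_coeff_def)
  then have "hj_rem (b + c) (b * c) (n - 2) = 0"
    using path_coeff_eq_hj_rem [of "n - 2"] p0 by simp
  ultimately show ?thesis using bc by (subst hj_length_eq_iff) auto
qed

end

section \<open>Uniqueness and existence for given leaf coefficients\<close>

lemma primitive_proportional_eq:
  fixes f g :: "'a \<Rightarrow> int"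
  assumes "\<And>i. i \<in> A \<Longrightarrow> p * f i = q * g i" "p > 0" "q > 0"
    and "Gcd (f ` A) = 1" "Gcd (g ` A) = 1" and "i \<in> A"
  shows "f i = g i"
proof -
  have "(*) p ` f ` A = (*) q ` g ` A"
    using assms(1) by (force simp: image_image)
  then have "Gcd ((*) p ` f ` A) = Gcd ((*) q ` g ` A)" by simp
  \<comment> \<open>A positive factor scales the gcd, and both families have gcd 1.\<close>
  then have "p = q" using assms(2-5) by (simp add: Gcd_mult)
  then show ?thesis using assms(1) [OF \<open>i \<in> A\<close>] assms(2) by simp
qed

text \<open>Every such r is proportional to the vector \<open>R\<close> = (c, b, h_0, h_1, ...), so
  primitivity fixes r; then d_i is the neighbour sum at i divided by r_i.\<close>

lemma smooth_bident_structure_unique: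
  fixes b c :: int
  assumes n: "n \<ge> 4" and bc: "b \<ge> 2" "c \<ge> 2"
    and s1: "arithmetical_structure n (bident_edges n) d r" "smooth_bident n d" "d $ 0 = b" "d $ 1 = c"
    and s2: "arithmetical_structure n (bident_edges n) d' r'" "smooth_bident n d'"
      "d' $ 0 = b" "d' $ 1 = c"
  shows "d = d' \<and> r = r'"
proof -
  define h where "h = hj_rem (b + c) (b * c)"
  define R where "R i = (if i = 0 then c else if i = 1 then b else h (i - 2))" for i
  have proportional: "b * c * x $ i = path_coeff n x 0 * R i"
    if "arithmetical_structure n (bident_edges n) e x" "smooth_bident n e" "e $ 0 = b" "e $ 1 = c"
      "i < n" for e x i
  proof -
    have leaves: "b * x $ 0 = path_coeff n x 0" "c * x $ 1 = path_coeff n x 0"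
      using that unfolding bident_structure_iff [OF n] by auto
    consider "i = 0" | "i = 1" | "i \<ge> 2" by linarith
    then show ?thesis
    proof cases
      case 3
      then have "i - 2 + 2 = i" by simp
      then have "path_coeff n x (i - 2) = x $ i" using that by (simp only: path_coeff_def if_True)
      then show ?thesis
        using path_coeff_eq_hj_rem [OF n bc that(1-4), of "i - 2"] 3 that
        by (simp add: R_def h_def)
    qed (use leaves in \<open>auto simp: R_def algebra_simps\<close>)
  qed
  let ?p = "path_coeff n r 0" and ?p' = "path_coeff n r' 0"
  have pos: "?p > 0" "?p' > 0"
    using path_coeff_pos [OF n bc s1] path_coeff_pos [OF n bc s2] n by auto
  have "r $ i = r' $ i" if "i < n" for i
  proof (rule primitive_proportional_eq [where A = "{..<n}"])
    fix j assume "j \<in> {..<n}"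
    then have "?p' * (b * c * r $ j) = ?p * (b * c * r' $ j)"
      using proportional [OF s1, of j] proportional [OF s2, of j] by simp
    then have "b * c * (?p' * r $ j) = b * c * (?p * r' $ j)"
      by (simp only: mult.left_commute [of _ "b * c"])
    then show "?p' * r $ j = ?p * r' $ j" using bc by simp
  qed (use s1(1) s2(1) pos that in \<open>auto simp: arithmetical_structure_iff\<close>)
  moreover have car: "r \<in> carrier_vec n" "r' \<in> carrier_vec n" "d \<in> carrier_vec n" "d' \<in> carrier_vec n"
    using s1(1) s2(1) by (auto simp: arithmetical_structure_iff)
  ultimately have r: "r = r'" by (intro eq_vecI) auto
  have "d $ i = d' $ i" if "i < n" for i
  proof -
    have "d $ i * r $ i = d' $ i * r $ i" "r $ i > 0"
      using s1(1) s2(1) that r by (auto simp: arithmetical_structure_iff)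
    then show ?thesis by simp
  qed
  then have "d = d'" using car by (intro eq_vecI) auto
  with r show ?thesis by simp
qed

text \<open>The vector (c, b, h_0, h_1, ...) is divided by its gcd to give r; the quotients of the
  divisions serve as d_1, d_2, ..., with the forced value d_0 = 1.\<close>

lemma smooth_bident_structure_exists:
  fixes b c :: int
  assumes n: "n \<ge> 4" and bc: "b \<ge> 2" "c \<ge> 2"
    and len: "hj_length (b + c) (b * c) = n - 2"
  shows "\<exists>d r. arithmetical_structure n (bident_edges n) d r \<and> smooth_bident n d \<and>
    d $ 0 = b \<and> d $ 1 = c"
proof -
  define h where "h = hj_rem (b + c) (b * c)"
  have h_pos: "h i > 0" if "i < n - 2" for i
    using len bc that by (simp add: hj_length_eq_iff h_def)
  have h_end: "h (n - 2) = 0"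
    using len bc by (simp add: hj_length_eq_iff h_def)
  have "b * c - b - c = (b - 1) * (c - 1) - 1" by (simp add: algebra_simps)
  moreover have "(b - 1) * (c - 1) \<ge> 1 * 1" using bc by (intro mult_mono) auto
  ultimately have h1: "h 1 = b * c - b - c"
    using bc unfolding h_def One_nat_def hj_rem.simps
    by (intro mod_eqI_int [where k = "-1"]) auto
  have h0: "h 0 = b * c" by (simp add: h_def)
  have h_rec: "h (i + 2) = (- h i) mod h (i + 1)" for i
    using hj_rem_Suc_Suc by (simp add: h_def del: hj_rem.simps)
  have h_dec: "h (i + 1) < h i" if "i < n - 2" for i
  proof (cases i)
    case 0
    then show ?thesis using h0 h1 bc by simp
  next
    case (Suc k)
    then show ?thesis using h_rec [of k] h_pos [OF that] by simp
  qed
  define q where "q i = (h i + h (i + 2)) div h (i + 1)" for i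
  have q: "q i * h (i + 1) = h i + h (i + 2)" for i
  proof -
    have "h (i + 1) dvd h i + h (i + 2)"
      unfolding h_rec by (metis add.commute add.inverse_inverse dvd_minus_mod diff_conv_add_uminus
          dvd_minus_iff minus_diff_eq)
    then show ?thesis by (simp add: q_def)
  qed
  \<comment> \<open>Since h_i > h_{i+1} and h_{i+2} >= 0, the sum h_i + h_{i+2} exceeds h_{i+1}, so
    the quotient exceeds 1.\<close>
  have q2: "q i \<ge> 2" if "i < n - 3" for i
  proof -
    have "h (i + 1) > 0" using h_pos that by simp
    moreover have "h (i + 2) \<ge> 0" unfolding h_rec using \<open>h (i + 1) > 0\<close> by simp
    moreover have "h i > h (i + 1)" using h_dec that by simp
    ultimately have "1 * h (i + 1) < q i * h (i + 1)" unfolding q by simp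
    then show ?thesis using \<open>h (i + 1) > 0\<close> by (simp add: mult_less_cancel_right)
  qed
  define R where "R i = (if i = 0 then c else if i = 1 then b else h (i - 2))" for i
  have R_pos: "R i > 0" if "i < n" for i
    using that bc h_pos n by (auto simp: R_def)
  define g where "g = Gcd (R ` {..<n})"
  have g_dvd: "g dvd R i" if "i < n" for i using that by (auto simp: g_def)
  have "g \<ge> 0" by (simp add: g_def)
  moreover have "g \<noteq> 0" using g_dvd [of 0] R_pos [of 0] n by auto
  ultimately have g: "g > 0" by simp
  define r where "r = vec n (\<lambda>i. R i div g)"
  define d where "d = vec n (\<lambda>i. if i = 0 then b else if i = 1 then c else
    if i = 2 then 1 else q (i - 3))"
  have gr: "g * r $ i = R i" if "i < n" for i
    using that g_dvd by (simp add: r_def)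
  have r_pos: "r $ i > 0" if "i < n" for i
    using gr [OF that] R_pos [OF that] g by (metis zero_less_mult_pos)
  have g\<rho>: "g * path_coeff n r i = h i" if "i \<le> n - 2" for i
  proof (cases "i = n - 2")
    case True
    then show ?thesis using h_end by (simp add: path_coeff_def)
  next
    case False
    then have "i + 2 < n" using that n by linarith
    then show ?thesis using gr [of "i + 2"] by (simp add: path_coeff_def R_def)
  qed
  have "g = Gcd ((*) g ` (\<lambda>i. r $ i) ` {..<n})"
    unfolding image_image by (subst g_def) (auto intro!: arg_cong [where f = Gcd] image_cong simp: gr)
  then have "g = g * Gcd ((\<lambda>i. r $ i) ` {..<n})" using g by (simp add: Gcd_mult abs_mult)
  then have prim: "Gcd ((\<lambda>i. r $ i) ` {..<n}) = 1" using g by simp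
  \<comment> \<open>The vertex equations are checked after multiplication by g, where the entries of
    r become those of \<open>R\<close>.\<close>
  have cancel: "x = y" if "g * x = g * y" for x y using that g by simp
  have lv: "g * r $ 0 = c" "g * r $ 1 = b" using gr [of 0] gr [of 1] n by (auto simp: R_def)
  have "d $ 0 * r $ 0 = path_coeff n r 0"
    by (rule cancel) (use lv g\<rho> [of 0] h0 n in \<open>simp add: d_def\<close>)
  moreover have "d $ 1 * r $ 1 = path_coeff n r 0"
    by (rule cancel) (use lv g\<rho> [of 0] h0 n in \<open>simp add: d_def\<close>)
  moreover have "d $ 2 * path_coeff n r 0 = r $ 0 + r $ 1 + path_coeff n r 1"
    by (rule cancel) (use lv g\<rho> [of 0] g\<rho> [of 1] h0 h1 n in \<open>simp add: d_def distrib_left\<close>)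
  moreover have "d $ (i + 3) * path_coeff n r (i + 1) = path_coeff n r i + path_coeff n r (i + 2)"
    if "i < n - 3" for i
  proof (rule cancel)
    have "g * (d $ (i + 3) * path_coeff n r (i + 1)) = q i * (g * path_coeff n r (i + 1))"
      using that by (simp add: d_def)
    also have "\<dots> = g * path_coeff n r i + g * path_coeff n r (i + 2)"
      using that g\<rho> [of i] g\<rho> [of "i + 1"] g\<rho> [of "i + 2"] q [of i] by simp
    finally show "g * (d $ (i + 3) * path_coeff n r (i + 1))
        = g * (path_coeff n r i + path_coeff n r (i + 2))" by (simp add: distrib_left)
  qed
  moreover have "d $ i > 0" if "i < n" for i
  proof (cases "i < 3")
    case True
    then show ?thesis using that bc by (auto simp: d_def)
  next
    case False
    then have "q (i - 3) \<ge> 2" using q2 that by simp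
    then show ?thesis using False that by (simp add: d_def)
  qed
  moreover have "d \<in> carrier_vec n" "r \<in> carrier_vec n" by (auto simp: d_def r_def)
  ultimately have "arithmetical_structure n (bident_edges n) d r"
    unfolding bident_structure_iff [OF n] using prim r_pos by blast
  moreover have "smooth_bident n d"
    using n bc q2 by (auto simp: smooth_bident_def d_def)
  moreover have "d $ 0 = b" "d $ 1 = c" using n by (auto simp: d_def)
  ultimately show ?thesis by blast
qed

text \<open>The factor r_y cancels, leaving r_0 / r_x, which is d_x by the equation at v_x.\<close>

lemma rbar_v_y_eq_iff:
  assumes "n \<ge> 4" "arithmetical_structure n (bident_edges n) d r"
  shows "rbar r $ 1 = of_nat b \<longleftrightarrow> d $ 0 = int b"
proof -
  have r: "r $ 0 > 0" "r $ 1 > 0" "r \<in> carrier_vec n" and eq: "d $ 0 * r $ 0 = r $ 2"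
    using assms(2) \<open>n \<ge> 4\<close> unfolding bident_structure_iff [OF assms(1)]
    by (auto simp: path_coeff_def numeral_2_eq_2)
  have "rbar r $ 1 = of_int (r $ 2) / of_int (r $ 0)"
    using r \<open>n \<ge> 4\<close> by (simp add: rbar_def numeral_2_eq_2)
  also have "\<dots> = of_int (d $ 0)" using r by (simp add: eq [symmetric])
  finally show ?thesis by (metis of_int_eq_iff of_int_of_nat_eq)
qed

theorem theorem3p5:
  fixes b n :: nat
  assumes "b \<ge> 2" and "n \<ge> b^2 + b"
  shows "card {(d, r). arithmetical_structure n (bident_edges n) d r \<and>
                       smooth_bident n d \<and> rbar r $ v_y = of_nat b} = b^2"
proof -
  have "b ^ 2 \<ge> 2 * 2" using assms(1) using mult_le_mono [of 2 b 2 b] by (simp add: power2_eq_square)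
  then have n: "n \<ge> 4" using assms(2) by linarith
  let ?S = "{(d, r). arithmetical_structure n (bident_edges n) d r \<and>
                       smooth_bident n d \<and> rbar r $ v_y = of_nat b}"
  let ?C = "{c. c \<ge> 2 \<and> hj_length (int b + c) (int b * c) = n - 2}"
  have S: "?S = {(d, r). arithmetical_structure n (bident_edges n) d r \<and>
                         smooth_bident n d \<and> d $ 0 = int b}"
    using rbar_v_y_eq_iff [OF n] by blast
  have b: "int b \<ge> 2" using assms(1) by simp
  \<comment> \<open>A structure is sent to d_y: injective by uniqueness, into the set by the length
    computation, onto it by existence.\<close>
  have "bij_betw (\<lambda>(d, r). d $ 1) ?S ?C"
    unfolding bij_betw_def
  proof (intro conjI equalityI subsetI)
    show "inj_on (\<lambda>(d, r). d $ 1) ?S"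
      unfolding S inj_on_def
      using smooth_bident_structure_unique [OF n b] by (auto simp: smooth_bident_def)
  next
    fix c assume "c \<in> (\<lambda>(d, r). d $ 1) ` ?S"
    then show "c \<in> ?C"
      unfolding S using hj_length_of_structure [OF n b] by (auto simp: smooth_bident_def)
  next
    fix c assume "c \<in> ?C"
    then show "c \<in> (\<lambda>(d, r). d $ 1) ` ?S"
      unfolding S using smooth_bident_structure_exists [OF n b, of c] by force
  qed
  then have "card ?S = card ?C" by (rule bij_betw_same_card)
  \<comment> \<open>Here N = n - 2, so n >= b^2 + b is exactly the bound required of N.\<close>
  also have "\<dots> = b ^ 2" using assms by (intro card_leaf_coefficients) auto
  finally show ?thesis .
qed

end
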